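(* Let $A$ be an octonion division algebra with center $F$, and let $f(x)=c_nx^n+\dots+c_1x+c_0\in A[x]$ with $c_0,\dots,c_n\in A$. If $\lambda_1$ and $\lambda_2$ in $A$ are two distinct roots of $f(x)$, then $\gamma=(\lambda_1-\lambda_2)\lambda_2(\lambda_1-\lambda_2)^{-1}$ is a root of the polynomial $$h(x)=d_{n-1}x^{n-1}+\dots+d_1x+d_0,$$ where for each $k\in\{0,\dots,n-1\}$ $$d_k=\gamma^k\left((\gamma^{-k}((\lambda_1-\lambda_2)^{-1}c_n))\lambda_1^{n-1-k}+\dots+\gamma^{-k}((\lambda_1-\lambda_2)^{-1}c_{k+1})\right),$$ that is, $$d_k=\gamma^k\left(\sum_{m=k+1}^{n}\Big(\gamma^{-k}\big((\lambda_1-\lambda_2)^{-1}c_m\big)\Big)\lambda_1^{m-1-k}\right).$$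
   Context: An octonion algebra $A$ over a field $F$ (of any characteristic) is a Cayley-Dickson doubling $A=Q\oplus Q\ell$ of a quaternion algebra $Q$ over $F$, with multiplication $(q+r\ell)(s+t\ell)=qs+\gamma_0\overline{t}r+(r\overline{s}+tq)\ell$ for $q,r,s,t\in Q$, where $\gamma_0\in F^\times$ is fixed and $z\mapsto\overline{z}$ is the canonical involution of $Q$. It is nonassociative but alternative (any two elements lie in an associative subalgebra), so powers of an element, inverses of nonzero elements in a division algebra, and conjugation $z\lambda z^{-1}$ are well defined. It is a division algebra if every nonzero element is invertible. The ring of (central) polynomials is $A[x]=A\otimes_F F[x]$; the indeterminate $x$ commutes and associates with all elements, and every polynomial is written in the standard form $f(x)=c_nx^n+\dots+c_1x+c_0$ with coefficients $c_i\in A$ on the left. For $\lambda\in A$, $f(\lambda)$ denotes $c_n\lambda^n+\dots+c_1\lambda+c_0\in A$, and $\lambda$ is a root of $f(x)$ if $f(\lambda)=0$. *)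

theory Defs
  imports "HOL-Computational_Algebra.Polynomial"
begin

text \<open>
  Quaternion algebras over a field of arbitrary characteristic: central simple
  algebras of dimension 4.
\<close>

locale quaternion_algebra = vector_space scale
  for scale :: "'f::field \<Rightarrow> 'q::ring_1 \<Rightarrow> 'q" +
  assumes scale_mult_left: "scale a (x * y) = scale a x * y"
    and scale_mult_right: "scale a (x * y) = x * scale a y"
    and dim_4: "dim (UNIV :: 'q set) = 4"
    and central: "{z :: 'q. \<forall>x. z * x = x * z} = range (\<lambda>a. scale a 1)"
    and simple: "\<lbrakk>0 \<in> I; \<And>x y. x \<in> I \<Longrightarrow> y \<in> I \<Longrightarrow> x + y \<in> I;
        \<And>a x. x \<in> I \<Longrightarrow> a * x \<in> I; \<And>a x. x \<in> I \<Longrightarrow> x * a \<in> I\<rbrakk>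
      \<Longrightarrow> I = {0} \<or> I = (UNIV :: 'q set)"

text \<open>
  The canonical involution of a quaternion algebra is its only \<open>F\<close>-linear involution for which
  all traces \<open>q + bar q\<close> and norms \<open>q * bar q\<close> are scalars.
\<close>

locale canonical_involution = quaternion_algebra scale
  for scale :: "'f::field \<Rightarrow> 'q::ring_1 \<Rightarrow> 'q" +
  fixes bar :: "'q \<Rightarrow> 'q"
  assumes bar_add: "bar (x + y) = bar x + bar y"
    and bar_scale: "bar (scale a x) = scale a (bar x)"
    and bar_mult: "bar (x * y) = bar y * bar x"
    and bar_bar: "bar (bar x) = x"
    and trace_scalar: "x + bar x \<in> range (\<lambda>a. scale a 1)"
    and norm_scalar: "x * bar x \<in> range (\<lambda>a. scale a 1)"

text \<open>
  The octonion algebra \<open>A = Q \<oplus> Ql\<close> is the whole type \<open>'a\<close>, whose multiplication is not assumed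
  to be associative; \<open>emb\<close> is the inclusion of \<open>Q\<close> in \<open>A\<close>. The action of a scalar \<open>a\<close> on \<open>A\<close>
  is multiplication by \<open>emb (scale a 1)\<close>.
\<close>

locale octonion_algebra = canonical_involution scale bar
  for scale :: "'f::field \<Rightarrow> 'q::ring_1 \<Rightarrow> 'q" and bar :: "'q \<Rightarrow> 'q" +
  fixes \<gamma>\<^sub>0 :: 'f
    and emb :: "'q \<Rightarrow> 'a::{ab_group_add, power}"
    and l :: 'a
  assumes distrib_left_A: "(x::'a) * (y + z) = x * y + x * z"
    and distrib_right_A: "((x::'a) + y) * z = x * z + y * z"
    and one_left_A: "1 * (x::'a) = x"
    and one_right_A: "(x::'a) * 1 = x"
    and emb_add: "emb (q + r) = emb q + emb r"
    and emb_one: "emb 1 = 1"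
    and direct_sum: "\<exists>!(q, r). x = emb q + emb r * l"
    and gamma0_nonzero: "\<gamma>\<^sub>0 \<noteq> 0"
    and doubling: "(emb q + emb r * l) * (emb s + emb t * l) =
      emb (q * s + scale \<gamma>\<^sub>0 (bar t * r)) + emb (r * bar s + t * q) * l"

locale octonion_division_algebra = octonion_algebra scale bar \<gamma>\<^sub>0 emb l
  for scale :: "'f::field \<Rightarrow> 'q::ring_1 \<Rightarrow> 'q" and bar :: "'q \<Rightarrow> 'q"
    and \<gamma>\<^sub>0 :: 'f and emb :: "'q \<Rightarrow> 'a::{ab_group_add, power}" and l :: 'a +
  assumes invertible: "(z::'a) \<noteq> 0 \<Longrightarrow> \<exists>w. z * w = 1 \<and> w * z = 1"

text \<open>
  As in the library's division rings, the inverse is totalised by sending 0 to 0.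
\<close>

definition alg_inverse :: "'a::{zero, one, times} \<Rightarrow> 'a" where
  "alg_inverse z = (if z = 0 then 0 else THE w. z * w = 1 \<and> w * z = 1)"

text \<open>
  The library's \<open>poly\<close> needs a commutative coefficient ring; here the coefficients are
  multiplied from the left onto the powers of the argument.
\<close>

definition eval_left :: "'a::{comm_monoid_add, power} poly \<Rightarrow> 'a \<Rightarrow> 'a" where
  "eval_left f z = (\<Sum>k\<le>degree f. coeff f k * z ^ k)"

definition is_root :: "'a::{comm_monoid_add, power} poly \<Rightarrow> 'a \<Rightarrow> bool" where
  "is_root f z \<longleftrightarrow> eval_left f z = 0"

text \<open>
  The base field is automatically the centre (the elements commuting and associating with
  everything) of an octonion algebra.
\<close>

definition alg_center :: "'a::times set" where
  "alg_center = {z. \<forall>x y. z * x = x * z \<and> (z * x) * y = z * (x * y)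
      \<and> (x * z) * y = x * (z * y) \<and> (x * y) * z = x * (y * z)}"

context octonion_algebra
begin

lemma emb_0: "emb 0 = 0"
  using emb_add[of 0 0] by simp

lemma mult_0_A: "0 * (x::'a) = 0"
  using distrib_right_A[of 0 0 x] by simp

lemma decomp_eq: "emb q + emb r * l = emb s + emb t * l \<longleftrightarrow> q = s \<and> r = t"
  using direct_sum[of "emb q + emb r * l"] by auto

lemma bar_1: "bar 1 = 1"
  by (metis bar_bar bar_mult mult.right_neutral mult_1)

lemma bar_0: "bar 0 = 0"
  using bar_add[of 0 0] by simp

lemma scalar_commute: "scale a 1 * x = x * scale a 1"
  using central by blast

lemma scale_scalar: "scale a x = scale a 1 * x"
  using scale_mult_left[of a 1 x] by simp

lemma bar_scalar: "bar (scale a 1) = scale a 1"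
  by (simp add: bar_scale bar_1)

lemma not_commutative: "\<not> (\<forall>x y :: 'q. x * y = y * x)"
proof
  assume "\<forall>x y :: 'q. x * y = y * x"
  then have "range (\<lambda>a. scale a 1) = (UNIV :: 'q set)"
    using central by blast
  then have "span {1} = (UNIV :: 'q set)"
    by (simp add: span_singleton)
  then have "dim (UNIV :: 'q set) \<le> card {1 :: 'q}"
    by (intro dim_le_card) auto
  then show False
    using dim_4 by simp
qed

lemma alg_center_eq: "(alg_center :: 'a set) = range (\<lambda>a. emb (scale a 1))"
proof (intro equalityI subsetI)
  fix z :: 'a
  assume z: "z \<in> alg_center"
  obtain q r where qr: "z = emb q + emb r * l"
    using direct_sum[of z] by auto
  have comm: "z * x = x * z" for x
    using z by (auto simp: alg_center_def)
  have 1: "q * s = s * q \<and> r * bar s = r * s" for s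
    using comm[of "emb s + emb 0 * l"] by (simp add: qr doubling decomp_eq bar_0)
  have 2: "scale \<gamma>\<^sub>0 (bar t * r) = scale \<gamma>\<^sub>0 (bar r * t)" for t
    using comm[of "emb 0 + emb t * l"] by (simp add: qr doubling decomp_eq)
  have 3: "bar t * r = bar r * t" for t
    using 2[of t] gamma0_nonzero by simp
  have "r = bar r"
    using 3[of 1] by (simp add: bar_1)
  then have 4: "bar t * r = r * bar t" for t
    using 3[of t] 1[of t] by simp
  have 5: "t * r = r * t" for t
    using 4[of "bar t"] by (simp add: bar_bar)
  then have "r \<in> {z. \<forall>x. z * x = x * z}"
    by simp
  then obtain a where a: "r = scale a 1"
    unfolding central by blast
  have "r = 0"
  proof (rule ccontr)
    assume "r \<noteq> 0"
    then have "a \<noteq> 0" using a by auto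
    have "bar s = s" for s
    proof -
      have "scale a (bar s) = scale a s"
        using 1[of s] by (simp add: a scale_scalar[of a "bar s"] scale_scalar[of a s] del: scale_cancel_left)
      then show ?thesis using \<open>a \<noteq> 0\<close> by simp
    qed
    then show False
      using not_commutative bar_mult by (metis (full_types))
  qed
  moreover have "q \<in> {z. \<forall>x. z * x = x * z}"
    using 1 by simp
  then obtain b where "q = scale b 1"
    unfolding central by blast
  ultimately show "z \<in> range (\<lambda>a. emb (scale a 1))"
    using qr by (simp add: emb_0 mult_0_A)
next
  fix z :: 'a
  assume "z \<in> range (\<lambda>a. emb (scale a 1))"
  then obtain a where a: "z = emb (scale a 1) + emb 0 * l"
    by (auto simp: emb_0 mult_0_A)
  show "z \<in> alg_center"
    unfolding alg_center_def
  proof (intro CollectI allI)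
    fix x y :: 'a
    obtain q r where x: "x = emb q + emb r * l" using direct_sum[of x] by auto
    obtain s t where y: "y = emb s + emb t * l" using direct_sum[of y] by auto
    show "z * x = x * z \<and> (z * x) * y = z * (x * y)
      \<and> (x * z) * y = x * (z * y) \<and> (x * y) * z = x * (y * z)"
      unfolding a x y doubling decomp_eq
      by (simp add: bar_0 bar_1 bar_mult bar_scale bar_add scale_right_distrib
          scale_mult_left[symmetric] scale_mult_right[symmetric] scale_left_commute
          distrib_left distrib_right mult.assoc mult.commute[of a "\<gamma>\<^sub>0"])
  qed
qed

end

end

theory Submission
  imports Defs
begin

text \<open>
  The proof works in every alternative division ring, and octonions enter only because doubling a
  quaternion algebra gives an alternative algebra (\<open>left_alternative_A\<close>, \<open>right_alternative_A\<close>).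

  Write \<open>\<delta> = \<rho>\<^sub>1 - \<rho>\<^sub>2\<close>, so that \<open>\<gamma> * \<delta> = \<delta> * \<rho>\<^sub>2\<close>. A summand of \<open>d k * \<gamma> ^ k\<close> has the
  form \<open>(\<gamma> ^ k * ((\<gamma> ^ -k * u) * v)) * \<gamma> ^ k\<close>, where \<open>u\<close> is the product of the inverse of \<open>\<delta>\<close> with \<open>c m\<close>
  and \<open>v\<close> is a power of \<open>\<rho>\<^sub>1\<close>. The middle Moufang identity \<open>(a * (x * y)) * a = (a * x) * (y * a)\<close>
  turns it into \<open>u * (v * \<gamma> ^ k)\<close> (\<open>sandwich_power\<close>); the powers of \<open>\<gamma>\<close> in the
  coefficients are there to make this happen. Collecting the terms that belong to one \<open>c m\<close>, the value
  of \<open>h\<close> at \<open>\<gamma>\<close> becomes the sum over \<open>m\<close> of \<open>u\<close> times \<open>\<Sum>k<m. \<rho>\<^sub>1 ^ (m - 1 - k) * \<gamma> ^ k\<close>.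

  That inner sum is a noncommutative geometric sum. Multiplied by \<open>\<delta>\<close> on the right, it
  telescopes to \<open>\<rho>\<^sub>1 ^ m - \<rho>\<^sub>2 ^ m\<close>, since \<open>\<gamma> ^ k * \<delta> = \<delta> * \<rho>\<^sub>2 ^ k\<close>
  (\<open>sum_power_conjugate_power\<close>). A second use of the middle Moufang identity, now with the inverse of \<open>\<delta>\<close>
  on the outside, shows that the value of \<open>h\<close> at \<open>\<gamma>\<close> is the difference of the values of \<open>f\<close> at \<open>\<rho>\<^sub>1\<close>
  and \<open>\<rho>\<^sub>2\<close>, multiplied on both sides by the inverse of \<open>\<delta>\<close>. Both values are zero.

  Nonassociativity is controlled by associators: they alternate, they vanish on powers of
  elements on which they vanish (\<open>associator_powers\<close>), and they vanish when two of the entries are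
  inverse to each other (\<open>inverse_associates\<close>).
\<close>

section \<open>Alternative rings\<close>

text \<open>
  The argument \<open>ty\<close> only names the type of the elements, since the axioms speak of the type-class
  operations of that type.
\<close>

locale alternative_ring =
  fixes ty :: "'a::{ab_group_add, power} itself"
  assumes distrib_left: "(x::'a) * (y + z) = x * y + x * z"
    and distrib_right: "((x::'a) + y) * z = x * z + y * z"
    and one_left [simp]: "1 * (x::'a) = x"
    and one_right [simp]: "(x::'a) * 1 = x"
    and left_alternative: "(x * x) * (y::'a) = x * (x * y)"
    and right_alternative: "((y::'a) * x) * x = y * (x * x)"
begin

lemma zero_left [simp]: "0 * (x::'a) = 0"
  using distrib_right[of 0 0 x] by simp

lemma zero_right [simp]: "(x::'a) * 0 = 0"
  using distrib_left[of x 0 0] by simp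

lemma minus_left: "(- (x::'a)) * y = - (x * y)"
  using distrib_right[of "- x" x y] by (simp add: eq_neg_iff_add_eq_0)

lemma minus_right: "(x::'a) * (- y) = - (x * y)"
  using distrib_left[of x "- y" y] by (simp add: eq_neg_iff_add_eq_0)

lemma diff_left: "((x::'a) - y) * z = x * z - y * z"
  using distrib_right[of x "- y" z] by (simp add: minus_left)

lemma diff_right: "(x::'a) * (y - z) = x * y - x * z"
  using distrib_left[of x y "- z"] by (simp add: minus_right)

lemmas expand = distrib_left distrib_right minus_left minus_right diff_left diff_right

lemma sum_left: "(\<Sum>i\<in>I. f i) * (y::'a) = (\<Sum>i\<in>I. f i * y)"
  by (induction I rule: infinite_finite_induct) (simp_all add: distrib_right)

lemma sum_right: "(y::'a) * (\<Sum>i\<in>I. f i) = (\<Sum>i\<in>I. y * f i)"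
  by (induction I rule: infinite_finite_induct) (simp_all add: distrib_left)

definition associator :: "'a \<Rightarrow> 'a \<Rightarrow> 'a \<Rightarrow> 'a" where
  "associator x y z = (x * y) * z - x * (y * z)"

lemma associator_eq_0_iff: "associator x y z = 0 \<longleftrightarrow> (x * y) * z = x * (y * z)"
  by (simp add: associator_def)

lemma associator_add:
  "associator (x + x') y z = associator x y z + associator x' y z"
  "associator x (y + y') z = associator x y z + associator x y' z"
  "associator x y (z + z') = associator x y z + associator x y z'"
  by (simp_all add: associator_def expand algebra_simps)

lemma associator_diff:
  "associator x (y - y') z = associator x y z - associator x y' z"
  by (simp add: associator_def expand algebra_simps)

lemma associator_one [simp]: "associator x 1 y = 0"
  "associator 1 x y = 0" "associator x y 1 = 0"
  by (simp_all add: associator_def)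

lemma associator_same_left [simp]: "associator x x y = 0"
  by (simp add: associator_def left_alternative)

lemma associator_same_right [simp]: "associator y x x = 0"
  by (simp add: associator_def right_alternative)

lemma associator_swap_left: "associator y x z = - associator x y z"
proof -
  have "associator (x + y) (x + y) z = 0"
    by (rule associator_same_left)
  then show ?thesis
    unfolding associator_add by (simp add: eq_neg_iff_add_eq_0 add.commute)
qed

lemma associator_swap_right: "associator x z y = - associator x y z"
proof -
  have "associator x (y + z) (y + z) = 0"
    by (rule associator_same_right)
  then show ?thesis
    unfolding associator_add by (simp add: eq_neg_iff_add_eq_0 add.commute)
qed

lemma associator_cycle: "associator x y z = associator y z x"
  by (metis associator_swap_left associator_swap_right minus_minus)

lemma flexible [simp]: "associator x y x = 0"
  using associator_swap_left[of x y x] by simp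

text \<open>Distributivity alone gives this relation between the five bracketings of \<open>w, x, y, z\<close>.\<close>

lemma associator_five_term:
  "associator (w * x) y z - associator w (x * y) z + associator w x (y * z) =
    w * associator x y z + associator w x y * z"
  by (simp add: associator_def expand algebra_simps)

text \<open>
  The five-term identity, applied to \<open>a, a, x, y\<close> and to \<open>x, y, a, a\<close> and to \<open>x, a, a, y\<close>, evaluates
  the associator of \<open>a * a, x, y\<close> in three ways; comparing them yields the next two lemmas.
\<close>

lemma
  shows associator_mult_left: "associator a (a * x) y = associator a x y * a"
    and associator_mult_right: "associator a (x * a) y = a * associator a x y"
proof -
  have 1: "associator (a * a) x y = associator a (a * x) y + a * associator a x y" for x y
    using associator_five_term[of a a x y] by (simp add: algebra_simps)
  have "- associator a (x * a) y - - associator (a * a) x y + - associator a x (a * y) = 0"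
    using associator_five_term[of x a a y]
    unfolding associator_swap_left[of a "x * a" y] associator_swap_left[of a x "a * y"]
      associator_swap_left[of "a * a" x y]
    by simp
  then have 2: "associator (a * a) x y = associator a (x * a) y + associator a x (a * y)"
    by (simp add: algebra_simps)
  have 3: "associator (a * a) x y = associator a x (y * a) + associator a x y * a" for x y
    using associator_five_term[of x y a a] associator_cycle[of a x "y * a"]
      associator_cycle[of a x y] associator_cycle[of "a * a" x y]
    by (simp add: algebra_simps)
  have 4: "associator (a * a) x y = associator a x (a * y) + a * associator a x y"
    using 1[of y x] associator_swap_right[of "a * a" x y] associator_swap_right[of a x y]
      associator_swap_right[of a x "a * y"]
    by (simp add: expand algebra_simps)
  have 5: "associator (a * a) x y = associator a (x * a) y + associator a x y * a"
    using 3[of y x] associator_swap_right[of "a * a" x y] associator_swap_right[of a x y]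
      associator_swap_right[of a "x * a" y]
    by (simp add: expand algebra_simps)
  show "associator a (x * a) y = a * associator a x y"
    using 2 4 by simp
  then show "associator a (a * x) y = associator a x y * a"
    using 1[of x y] 5 by simp
qed

lemma left_Moufang: "((a * x) * a) * y = a * (x * (a * (y::'a)))"
proof -
  have "((a * x) * a) * y - a * (x * (a * y)) = associator (a * x) a y + associator a x (a * y)"
    by (simp add: associator_def)
  also have "\<dots> = - associator a (a * x) y - associator a (a * y) x"
    by (simp add: associator_swap_left[of a "a * x"] associator_swap_right[of a "a * y"])
  also have "\<dots> = 0"
    by (simp add: associator_mult_left associator_swap_right[of a x y] expand)
  finally show ?thesis
    by simp
qed

text \<open>
  Passing from the right side to \<open>((a * x) * y) * a\<close> costs the associator of \<open>a * x, y, a\<close>, and passing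
  from there to the left side costs the associator of \<open>a, x, y\<close> times \<open>a\<close>. The two costs cancel.
\<close>

lemma middle_Moufang: "(a * (x * y)) * a = (a * x) * (y * (a::'a))"
proof -
  have "associator (a * x) y a = associator a x y * a"
    using associator_cycle[of a "a * x" y] by (simp add: associator_mult_left)
  then show ?thesis
    by (simp add: associator_def expand)
qed

section \<open>Powers and inverses in alternative rings\<close>

lemma associator_power_self [simp]: "associator x (x ^ n) y = 0"
  by (induction n) (simp_all add: associator_mult_left)

lemma power_mult_assoc: "x ^ Suc n * y = x * (x ^ n * (y::'a))"
  using associator_power_self[of x n y] by (simp add: associator_def)

lemma power_Suc_right: "x ^ n * x = (x::'a) ^ Suc n"
  by (induction n) (simp_all add: flexible[unfolded associator_eq_0_iff])

text \<open>
  By the five-term identity the associator of \<open>x ^ Suc n, y, z\<close> differs from that of \<open>x, x ^ n * y, z\<close>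
  by a multiple of the one of \<open>x ^ n, y, z\<close>.
\<close>

lemma associator_power_left:
  assumes "associator x y z = 0"
  shows "associator (x ^ n) y z = 0"
proof (induction n)
  case (Suc n)
  have "associator x (x ^ m * y) z = 0" for m
  proof (induction m)
    case (Suc m)
    then show ?case
      unfolding power_mult_assoc associator_mult_left by simp
  qed (simp add: assms)
  then show ?case
    using associator_five_term[of x "x ^ n" y z] Suc.IH by simp
qed simp

lemma associator_powers:
  assumes "associator x y z = 0"
  shows "associator (x ^ i) (y ^ j) (z ^ k) = 0"
  using assms by (metis associator_cycle associator_power_left)

text \<open>
  An associator \<open>p\<close> of \<open>w, z, y\<close> is killed by left multiplication by \<open>w\<close>. It cannot be nonzero,
  as the left Moufang identity and \<open>(w * (z * z)) * w = 1\<close> give \<open>p = w * (z * (z * (w * p)))\<close>.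
\<close>

lemma inverse_associates:
  assumes "z * w = (1::'a)" and "w * z = 1"
  shows "associator w z y = 0"
proof -
  define p where "p = associator w z y"
  have "w * p = 0"
    unfolding p_def using associator_mult_right[of w z y] assms by simp
  moreover have "w * (z * z) = z"
    using right_alternative[of w z] assms by simp
  ultimately have "p = 0"
    using left_Moufang[of w "z * z" p] assms by simp
  then show ?thesis
    unfolding p_def .
qed

lemma inverse_cancel_left:
  assumes "z * w = (1::'a)" and "w * z = 1"
  shows "w * (z * y) = y"
  using inverse_associates[OF assms] assms(2) by (metis associator_eq_0_iff one_left)

lemma inverse_cancel_right:
  assumes "z * w = (1::'a)" and "w * z = 1"
  shows "(y * z) * w = y"
  using inverse_associates[OF assms(2,1), of y] assms(1)
  by (metis associator_cycle associator_eq_0_iff one_right)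

lemma power_inverse_cancel:
  assumes "z * w = (1::'a)" and "w * z = 1"
  shows "z ^ k * (w ^ k * y) = y"
proof (induction k arbitrary: y)
  case (Suc k)
  have w: "w ^ Suc k * y = w ^ k * (w * y)"
    using associator_swap_left[of w "w ^ k" y]
    unfolding power_Suc_right[symmetric] by (simp add: associator_eq_0_iff)
  show ?case
    by (simp only: w power_mult_assoc[of z] Suc.IH inverse_cancel_left[OF assms(2,1)])
qed simp

end

locale alternative_division_ring = alternative_ring ty
  for ty :: "'a::{ab_group_add, power} itself" +
  assumes inverse_exists: "(z::'a) \<noteq> 0 \<Longrightarrow> \<exists>w. z * w = 1 \<and> w * z = 1"
begin

lemma
  assumes "(z::'a) \<noteq> 0"
  shows mult_alg_inverse: "z * alg_inverse z = 1"
    and alg_inverse_mult: "alg_inverse z * z = 1"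
proof -
  obtain w where w: "z * w = 1" "w * z = 1"
    using inverse_exists[OF assms] by blast
  have "v = w" if "z * v = 1 \<and> v * z = 1" for v
    using inverse_cancel_left[OF w, of v] that by simp
  then have "\<exists>!w. z * w = 1 \<and> w * z = 1"
    using w by blast
  from theI'[OF this] show "z * alg_inverse z = 1" "alg_inverse z * z = 1"
    using assms by (simp_all add: alg_inverse_def)
qed

section \<open>Factoring a difference of powers\<close>

context
  fixes a b \<delta> \<gamma> :: 'a
  assumes distinct: "a \<noteq> b"
    and \<delta>_def: "\<delta> = a - b"
    and \<gamma>_def: "\<gamma> = (\<delta> * b) * alg_inverse \<delta>"
begin

lemma \<delta>_inverse: "\<delta> * alg_inverse \<delta> = 1" "alg_inverse \<delta> * \<delta> = 1"
  using distinct mult_alg_inverse alg_inverse_mult by (simp_all add: \<delta>_def)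

lemma conjugate_mult: "\<gamma> * \<delta> = \<delta> * b"
  unfolding \<gamma>_def by (rule inverse_cancel_right[OF \<delta>_inverse(2,1)])

text \<open>
  The conjugation by \<open>\<delta>\<close> respects squares: as \<open>\<gamma>\<close> is \<open>\<delta> * b\<close> times the inverse of \<open>\<delta>\<close>, flexibility
  evaluates \<open>\<gamma> * (\<delta> * b)\<close> to \<open>(\<delta> * b) * b\<close>.
\<close>

lemma associator_conjugate: "associator \<gamma> \<delta> b = 0"
proof -
  have "\<gamma> * (\<delta> * b) = (\<delta> * b) * (alg_inverse \<delta> * (\<delta> * b))"
    unfolding \<gamma>_def using flexible associator_eq_0_iff by blast
  also have "\<dots> = (\<delta> * b) * b"
    by (simp add: inverse_cancel_left[OF \<delta>_inverse])
  finally show ?thesis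
    by (simp add: associator_def conjugate_mult)
qed

lemma conjugate_power_mult: "\<gamma> ^ k * \<delta> = \<delta> * b ^ k"
proof (induction k)
  case (Suc k)
  have "\<gamma> ^ Suc k * \<delta> = \<gamma> * (\<delta> * b ^ k)"
    unfolding power_mult_assoc Suc.IH ..
  also have "\<dots> = (\<gamma> * \<delta>) * b ^ k"
    using associator_powers[OF associator_conjugate, of 1 1 k] by (simp add: associator_eq_0_iff)
  also have "\<dots> = \<delta> * b ^ Suc k"
    using associator_cycle[of \<delta> b "b ^ k"] associator_power_self[of b k \<delta>]
    by (simp add: conjugate_mult associator_eq_0_iff)
  finally show ?case .
qed simp

text \<open>
  In an associative ring this is \<open>\<gamma> ^ k * \<delta> = (a - b) * b ^ k\<close> multiplied by \<open>a ^ j\<close>. Here the rebracketings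
  are justified by three vanishing associators, of \<open>a, \<gamma>, \<delta>\<close> and \<open>a, \<delta>, b\<close> and of \<open>a ^ j, b, b ^ k\<close>.
\<close>

lemma power_conjugate_power_mult:
  "(a ^ j * \<gamma> ^ k) * \<delta> = a ^ Suc j * b ^ k - a ^ j * b ^ Suc k"
proof -
  have a\<delta>b: "associator a \<delta> b = 0"
    by (simp add: \<delta>_def associator_diff)
  have "associator (b + \<delta>) \<gamma> \<delta> = associator b \<gamma> \<delta>"
    by (simp add: associator_add)
  also have "\<dots> = 0"
    using associator_conjugate by (simp add: associator_cycle[of b])
  finally have "associator a \<gamma> \<delta> = 0"
    by (simp add: \<delta>_def)
  then have "(a ^ j * \<gamma> ^ k) * \<delta> = a ^ j * (\<gamma> ^ k * \<delta>)"
    using associator_powers[of a \<gamma> \<delta> j k 1] by (simp add: associator_eq_0_iff)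
  also have "\<dots> = a ^ j * (\<delta> * b ^ k)"
    by (simp add: conjugate_power_mult)
  also have "\<dots> = (a ^ j * \<delta>) * b ^ k"
    using associator_powers[OF a\<delta>b, of j 1 k] by (simp add: associator_eq_0_iff)
  also have "\<dots> = a ^ Suc j * b ^ k - (a ^ j * b) * b ^ k"
    unfolding \<delta>_def diff_right diff_left power_Suc_right ..
  also have "(a ^ j * b) * b ^ k = a ^ j * b ^ Suc k"
    using associator_cycle[of "a ^ j" b "b ^ k"] by (simp add: associator_eq_0_iff)
  finally show ?thesis .
qed

text \<open>
  For commuting elements \<open>\<gamma> = b\<close>, and this is the usual factorisation of \<open>a ^ m - b ^ m\<close> by \<open>a - b\<close>.
\<close>

lemma sum_power_conjugate_power:
  "(\<Sum>k<m. a ^ (m - 1 - k) * \<gamma> ^ k) = (a ^ m - b ^ m) * alg_inverse \<delta>"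
proof -
  have "(\<Sum>k<m. a ^ (m - 1 - k) * \<gamma> ^ k) * \<delta> =
      (\<Sum>k<m. a ^ (m - k) * b ^ k - a ^ (m - Suc k) * b ^ Suc k)"
    unfolding sum_left
  proof (rule sum.cong)
    fix k assume "k \<in> {..<m}"
    then have "Suc (m - 1 - k) = m - k" "m - 1 - k = m - Suc k"
      by auto
    then show "(a ^ (m - 1 - k) * \<gamma> ^ k) * \<delta> = a ^ (m - k) * b ^ k - a ^ (m - Suc k) * b ^ Suc k"
      using power_conjugate_power_mult[of "m - 1 - k" k] by simp
  qed simp
  also have "\<dots> = a ^ m - b ^ m"
    by (subst sum_lessThan_telescope') simp
  finally show ?thesis
    by (metis inverse_cancel_right[OF \<delta>_inverse])
qed

section \<open>Dividing out a root\<close>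

text \<open>
  Sandwiching between two copies of \<open>\<gamma> ^ k\<close> moves the right copy inside by the middle Moufang identity,
  while the left copy cancels the power of the inverse. If \<open>\<gamma> = 0\<close> and \<open>k > 0\<close>, nothing
  cancels, but both sides vanish.
\<close>

lemma sandwich_power:
  "(\<gamma> ^ k * ((alg_inverse \<gamma> ^ k * u) * v)) * \<gamma> ^ k = u * (v * \<gamma> ^ k)"
proof (cases "\<gamma> = 0")
  case True
  then show ?thesis
    by (cases k) simp_all
next
  case False
  then show ?thesis
    by (simp add: middle_Moufang power_inverse_cancel mult_alg_inverse alg_inverse_mult)
qed

theorem conjugate_root_of_quotient:
  assumes "(\<Sum>m\<le>n. c m * a ^ m) = 0" and "(\<Sum>m\<le>n. c m * b ^ m) = 0"
  shows "(\<Sum>k<n. (\<gamma> ^ k * (\<Sum>m = k + 1..n.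
    (alg_inverse \<gamma> ^ k * (alg_inverse \<delta> * c m)) * a ^ (m - 1 - k))) * \<gamma> ^ k) = 0"
proof -
  let ?e = "alg_inverse \<delta>"
  have "(\<Sum>k<n. (\<gamma> ^ k * (\<Sum>m = k + 1..n.
      (alg_inverse \<gamma> ^ k * (?e * c m)) * a ^ (m - 1 - k))) * \<gamma> ^ k) =
    (\<Sum>k<n. \<Sum>m = Suc k..n. (?e * c m) * (a ^ (m - 1 - k) * \<gamma> ^ k))"
    by (simp only: sum_left sum_right sandwich_power Suc_eq_plus1)
  also have "\<dots> = (\<Sum>m\<le>n. (?e * c m) * (\<Sum>k<m. a ^ (m - 1 - k) * \<gamma> ^ k))"
    by (simp only: sum.nested_swap' sum_right)
  also have "\<dots> = (\<Sum>m\<le>n. (?e * (c m * (a ^ m - b ^ m))) * ?e)"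
    by (simp only: sum_power_conjugate_power middle_Moufang)
  also have "\<dots> = (?e * ((\<Sum>m\<le>n. c m * a ^ m) - (\<Sum>m\<le>n. c m * b ^ m))) * ?e"
    by (simp add: sum_left sum_right diff_right sum_subtractf flip: sum_subtractf)
  also have "\<dots> = 0"
    by (simp add: assms)
  finally show ?thesis .
qed

end

end

section \<open>Octonion algebras are alternative\<close>

lemma (in canonical_involution) bar_diff: "bar (x - y) = bar x - bar y"
  using bar_add[of "x - y" y] by (simp add: algebra_simps)

text \<open>
  Eliminating the involution by \<open>bar x = \<tau> - x\<close> with the scalar trace \<open>\<tau>\<close>, and squares by
  \<open>x\<^sup>2 = \<tau> x - \<nu>\<close> with the scalar norm \<open>\<nu>\<close>, brings quaternion expressions to a normal form.
\<close>

lemma (in canonical_involution) trace_norm_obtain: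
  obtains \<tau> \<nu> where "bar x = scale \<tau> 1 - x" and "x * x = scale \<tau> x - scale \<nu> 1"
    and "\<And>y. x * (x * y) = scale \<tau> (x * y) - scale \<nu> y"
proof -
  obtain \<tau> where "x + bar x = scale \<tau> 1"
    using trace_scalar[of x] by blast
  then have \<tau>: "bar x = scale \<tau> 1 - x"
    by (simp add: algebra_simps)
  obtain \<nu> where "x * bar x = scale \<nu> 1"
    using norm_scalar[of x] by blast
  then have \<nu>: "x * x = scale \<tau> x - scale \<nu> 1"
    by (simp add: \<tau> right_diff_distrib algebra_simps flip: scale_mult_right)
  then have "x * (x * y) = scale \<tau> (x * y) - scale \<nu> y" for y
    by (simp add: left_diff_distrib flip: scale_mult_left mult.assoc)
  with \<tau> \<nu> show thesis
    by (rule that)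
qed

lemma (in octonion_algebra)
  shows left_alternative_A: "(x * x) * (y::'a) = x * (x * y)"
    and right_alternative_A: "((y::'a) * x) * x = y * (x * x)"
proof -
  obtain q r where x: "x = emb q + emb r * l"
    using direct_sum[of x] by auto
  obtain s t where y: "y = emb s + emb t * l"
    using direct_sum[of y] by auto
  obtain \<tau>q \<nu>q where q: "bar q = scale \<tau>q 1 - q" "q * q = scale \<tau>q q - scale \<nu>q 1"
      "\<And>y. q * (q * y) = scale \<tau>q (q * y) - scale \<nu>q y"
    using trace_norm_obtain[of q] by blast
  obtain \<tau>r \<nu>r where r: "bar r = scale \<tau>r 1 - r" "r * r = scale \<tau>r r - scale \<nu>r 1"
      "\<And>y. r * (r * y) = scale \<tau>r (r * y) - scale \<nu>r y"
    using trace_norm_obtain[of r] by blast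
  obtain \<tau>s where s: "bar s = scale \<tau>s 1 - s"
    using trace_norm_obtain[of s] by blast
  obtain \<tau>t where t: "bar t = scale \<tau>t 1 - t"
    using trace_norm_obtain[of t] by blast
  note normalise = bar_add bar_mult bar_scale bar_diff bar_1 q r s t algebra_simps
  show "(x * x) * y = x * (x * y)"
    unfolding x y doubling decomp_eq
    by (simp add: normalise flip: scale_mult_left scale_mult_right)
  show "(y * x) * x = y * (x * x)"
    unfolding x y doubling decomp_eq
    by (simp add: normalise flip: scale_mult_left scale_mult_right)
qed

lemma (in octonion_division_algebra) alternative_division_ring:
  "alternative_division_ring TYPE('a)"
  by unfold_locales
    (fact distrib_left_A distrib_right_A one_left_A one_right_A left_alternative_A
      right_alternative_A invertible)+

section \<open>Roots of octonion polynomials\<close>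

lemma (in alternative_ring) eval_left_sum_monom:
  "eval_left (\<Sum>k<n. monom (c k) k) z = (\<Sum>k<n. c k * (z::'a) ^ k)"
proof -
  let ?f = "\<Sum>k<n. monom (c k) k"
  have coeff: "coeff ?f k = (if k < n then c k else 0)" for k
    by (simp add: coeff_sum)
  have "eval_left ?f z = (\<Sum>k \<in> {..degree ?f} \<union> {..<n}. coeff ?f k * z ^ k)"
    unfolding eval_left_def
    by (rule sum.mono_neutral_left) (auto simp: coeff_eq_0)
  also have "\<dots> = (\<Sum>k<n. coeff ?f k * z ^ k)"
    by (rule sum.mono_neutral_right) (auto simp: coeff)
  finally show ?thesis
    by (simp add: coeff)
qed

theorem proposition2p3:
  fixes scale :: "'f::field \<Rightarrow> 'q::ring_1 \<Rightarrow> 'q"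
    and bar :: "'q \<Rightarrow> 'q"
    and \<gamma>\<^sub>0 :: 'f
    and emb :: "'q \<Rightarrow> 'a::{ab_group_add, power}"
    and l :: 'a
    and f h :: "'a poly"
    and c d :: "nat \<Rightarrow> 'a"
    and n :: nat
    and \<rho>\<^sub>1 \<rho>\<^sub>2 \<gamma> :: 'a
  assumes "octonion_division_algebra scale bar \<gamma>\<^sub>0 emb l"
    and "f = (\<Sum>k\<le>n. monom (c k) k)"
    and "is_root f \<rho>\<^sub>1" and "is_root f \<rho>\<^sub>2" and "\<rho>\<^sub>1 \<noteq> \<rho>\<^sub>2"
    and "\<gamma> = ((\<rho>\<^sub>1 - \<rho>\<^sub>2) * \<rho>\<^sub>2) * alg_inverse (\<rho>\<^sub>1 - \<rho>\<^sub>2)"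
    and "\<And>k. k < n \<Longrightarrow> d k = \<gamma> ^ k *
      (\<Sum>m = k + 1..n. (alg_inverse \<gamma> ^ k * (alg_inverse (\<rho>\<^sub>1 - \<rho>\<^sub>2) * c m)) * \<rho>\<^sub>1 ^ (m - 1 - k))"
    and "h = (\<Sum>k<n. monom (d k) k)"
  shows "is_root h \<gamma>"
proof -
  interpret octonion_division_algebra scale bar \<gamma>\<^sub>0 emb l
    by fact
  interpret A: alternative_division_ring "TYPE('a)"
    by (rule alternative_division_ring)
  have f: "(\<Sum>m\<le>n. c m * z ^ m) = eval_left f z" for z
    using A.eval_left_sum_monom[of c "Suc n" z] by (simp add: assms(2) lessThan_Suc_atMost)
  have "eval_left h \<gamma> = (\<Sum>k<n. d k * \<gamma> ^ k)"
    unfolding assms(8) by (rule A.eval_left_sum_monom)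
  also have "\<dots> = 0"
    using A.conjugate_root_of_quotient[OF assms(5) refl assms(6), where n = n and c = c] assms(3,4,7)
    by (simp add: f is_root_def)
  finally show ?thesis
    by (simp add: is_root_def)
qed

end
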